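(* (1) If a tight frame for $\mathbb{R}^n$ encounters $p<n$ erasures, the resulting set is never a tight frame. (2) If a tight frame for $\mathbb{R}^n$ encounters $p\ge n$ erasures, the resulting set is a tight frame if and only if the set of vectors removed form a tight frame themselves.
   Context: A finite family $\{x_j\}_{j\in J}$ of vectors in $\mathbb{R}^n$ is a tight frame for $\mathbb{R}^n$ if there is a constant $0<A<\infty$ with $\sum_{j\in J}|\langle x,x_j\rangle|^2=A\|x\|^2$ for all $x\in\mathbb{R}^n$. An erasure is the removal of one vector from the family; after $p$ erasures, $p$ vectors of the family have been removed, and the resulting set is the family of the remaining vectors.
   Formalization: It is assumed that at least one removed vector is nonzero and, in (2), that at least one remaining vector is nonzero; otherwise the claims fail, e.g. when only zero vectors are erased (or p = 0), or when all vectors are erased. *)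

theory Defs
  imports "HOL-Analysis.Analysis"
begin

(* Families are indexed, so repeated vectors count with multiplicity. *)
definition tight_frame :: "'i set \<Rightarrow> ('i \<Rightarrow> real ^ 'n) \<Rightarrow> bool" where
  "tight_frame J x \<longleftrightarrow>
     finite J \<and>
     (\<exists>A::real. 0 < A \<and> (\<forall>v. (\<Sum>j\<in>J. \<bar>v \<bullet> x j\<bar>\<^sup>2) = A * (norm v)\<^sup>2))"

end

(* Quadratic forms subtract: if J and F \<subseteq> J are tight with constants A and B, then J - F
   satisfies the frame identity with constant A - B, and testing it on a nonzero x j with
   j in J - F shows A - B > 0. A tight frame spans, so it has at least n vectors. *)
theory Submission
  imports Defs
begin

lemma tight_frame_Diff:
  assumes "tight_frame J x" "tight_frame F x" "F \<subseteq> J" "\<exists>j\<in>J - F. x j \<noteq> 0"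
  shows "tight_frame (J - F) x"
proof -
  obtain A where finJ: "finite J" and A: "\<And>v. (\<Sum>j\<in>J. \<bar>v \<bullet> x j\<bar>\<^sup>2) = A * (norm v)\<^sup>2"
    using assms(1) by (auto simp: tight_frame_def)
  obtain B where B: "\<And>v. (\<Sum>j\<in>F. \<bar>v \<bullet> x j\<bar>\<^sup>2) = B * (norm v)\<^sup>2"
    using assms(2) by (auto simp: tight_frame_def)
  have diff: "(\<Sum>j\<in>J - F. \<bar>v \<bullet> x j\<bar>\<^sup>2) = (A - B) * (norm v)\<^sup>2" for v
    by (simp only: sum_diff[OF finJ assms(3)] A B left_diff_distrib)
  obtain k where k: "k \<in> J - F" "x k \<noteq> 0"
    using assms(4) by blast
  have "0 < \<bar>x k \<bullet> x k\<bar>\<^sup>2"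
    using k(2) by simp
  also have "\<dots> \<le> (\<Sum>j\<in>J - F. \<bar>x k \<bullet> x j\<bar>\<^sup>2)"
    by (rule member_le_sum) (use k(1) finJ in auto)
  finally have "0 < (A - B) * (norm (x k))\<^sup>2"
    by (simp only: diff)
  then have "0 < A - B"
    by (simp add: zero_less_mult_iff)
  with finJ diff show ?thesis
    unfolding tight_frame_def by blast
qed

text \<open>With fewer than n vectors, some nonzero \<open>v\<close> is orthogonal to all of them,
  so the frame sum at \<open>v\<close> is 0 although \<open>A * (norm v)\<^sup>2\<close> is
  positive.\<close>

lemma tight_frame_card_ge:
  fixes x :: "'i \<Rightarrow> real ^ 'n"
  assumes "tight_frame J x"
  shows "CARD('n) \<le> card J"
proof (rule ccontr)
  assume less: "\<not> CARD('n) \<le> card J"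
  obtain A where finJ: "finite J" and "0 < A"
    and A: "\<And>v. (\<Sum>j\<in>J. \<bar>v \<bullet> x j\<bar>\<^sup>2) = A * (norm v)\<^sup>2"
    using assms by (auto simp: tight_frame_def)
  have "dim (x ` J) \<le> card (x ` J)"
    using finJ by (simp add: dim_le_card')
  also have "\<dots> \<le> card J"
    by (rule card_image_le[OF finJ])
  finally have "dim (x ` J) < DIM(real ^ 'n)"
    using less by simp
  then obtain v where "v \<noteq> 0" and v: "\<And>y. y \<in> span (x ` J) \<Longrightarrow> orthogonal v y"
    using orthogonal_to_subspace_exists by blast
  have "v \<bullet> x j = 0" if "j \<in> J" for j
    using v[OF span_base] that by (auto simp: orthogonal_def)
  then have "A * (norm v)\<^sup>2 = 0"
    using A[of v] by simp
  with \<open>0 < A\<close> \<open>v \<noteq> 0\<close> show False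
    by simp
qed

(* E indexes the erased vectors, so p is card E. Erasing only zero vectors, or all the
   nonzero ones, are degenerate cases in which the equivalence (and, in the former case,
   also the first claim) is false; they are excluded by hypothesis. *)
theorem corollary4p3p5:
  fixes x :: "'i \<Rightarrow> real ^ 'n" and J E :: "'i set" and p :: nat
  assumes "tight_frame J x"
    and "E \<subseteq> J" and "card E = p"
    and "\<exists>j\<in>E. x j \<noteq> 0"
  shows "(p < CARD('n) \<longrightarrow> \<not> tight_frame (J - E) x) \<and>
         (CARD('n) \<le> p \<longrightarrow> (\<exists>j\<in>J - E. x j \<noteq> 0) \<longrightarrow>
            (tight_frame (J - E) x \<longleftrightarrow> tight_frame E x))"
proof -
  \<comment> \<open>Erased and remaining indices are complementary in \<open>J\<close>, so
    \<open>tight_frame_Diff\<close> serves both directions.\<close>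
  have "J - (J - E) = E"
    using assms(2) by blast
  then have erased: "tight_frame E x" if "tight_frame (J - E) x"
    using tight_frame_Diff[OF assms(1) that] assms(4) by simp
  \<comment> \<open>Contrapositive of the first claim: a tight remainder makes the erased vectors
    tight, hence at least n in number.\<close>
  have "p \<ge> CARD('n)" if "tight_frame (J - E) x"
    using tight_frame_card_ge[OF erased[OF that]] assms(3) by simp
  with erased tight_frame_Diff[OF assms(1) _ assms(2)] show ?thesis
    by (auto simp: not_le[symmetric])
qed

end
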